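(* Let $\Gamma$ be a $\sigma$-compact locally compact abelian group, endowed with a proper translation-invariant metric inducing its topology, and let $\mu$ be its Haar measure. Let $f$ be a complex-valued continuous bounded function on $\Gamma$. Regard $f$ as an abstract pattern in $\mathrm{Map}(\Gamma,\mathbb{C},0)$ and $f\,d\mu$ as the element of $C_c(\Gamma)^*$ that sends $\varphi\in C_c(\Gamma)$ to $\int\varphi f\,d\mu$; both are regarded as abstract pattern spaces over $(\Gamma,\Gamma)$, where $\Gamma$ acts on itself by translation. Then $f$ and $f\,d\mu$ are mutually locally derivable.
   Context: $B(x,r)$ denotes the closed ball; proper means all closed balls are compact; $\mathrm{Cl}(X)$ is the set of closed subsets of $X$. Abstract pattern space over $(X,\Gamma)$ ($\Gamma$ acting on $X$ by homeomorphisms): a non-empty set $\Pi$ with a map $\Pi\times\mathrm{Cl}(X)\to\Pi$, $(\mathcal{P},C)\mapsto\mathcal{P}\wedge C$ and an action of $\Gamma$ on $\Pi$ such that (1) $(\mathcal{P}\wedge C_1)\wedge C_2=\mathcal{P}\wedge(C_1\cap C_2)$; (2) for each $\mathcal{P}$ there is a (unique) closed set $\operatorname{supp}\mathcal{P}$ with $\mathcal{P}\wedge C=\mathcal{P}\iff C\supset\operatorname{supp}\mathcal{P}$ for all closed $C$; (3) $(\gamma\mathcal{P})\wedge(\gamma C)=\gamma(\mathcal{P}\wedge C)$. Instances: (i) $\mathrm{Map}(X,\mathbb{C},0)$, the set of all maps $f\colon X\to\mathbb{C}$, with $(f\wedge C)(x)=f(x)$ for $x\in C$ and $0$ for $x\notin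 C$, and $(\gamma f)(x)=f(\gamma^{-1}x)$. (ii) $C_c(X)^{*}$ ($X$ locally compact and $\sigma$-compact), the dual of the space $C_c(X)$ of compactly supported continuous complex functions with the inductive limit topology; each element $\Phi$ has the form $\Phi(\varphi)=\int_X\varphi u\,dm$ for a unique positive Borel (Radon) measure $m$ and a Borel map $u\colon X\to\{z\in\mathbb{C}:|z|=1\}$. The cutting-off is $(\Phi\wedge C)(\varphi)=\int_C\varphi u\,dm$ (the same formula holds when $u$ is any bounded Borel map representing $\Phi$ with respect to a positive measure $m$), and the action is $(\gamma\Phi)(\varphi)=\Phi(\gamma^{-1}\varphi)$ where $(\gamma\varphi)(x)=\varphi(\gamma^{-1}x)$. Local derivability: for abstract patterns $\mathcal{P}_1,\mathcal{P}_2$ in abstract pattern spaces over $(X,\Gamma)$, $(Y,\Gamma)$ ($\Gamma$ acting by isometries on proper metric spaces), $\mathcal{P}_2$ is locally derivable from $\mathcal{P}_1$ if there are $x_0\in X$, $y_0\in Y$, $R_0\geqq0$ such that for all $\gamma,\eta\in\Gamma$, $R\geqq0$: $(\gamma\mathcal{P}_1)\wedge B(x_0,R+R_0)=(\eta\mathcal{P}_1)\wedge B(x_0,R+R_0)$ implies $(\gamma\mathcal{P}_2)\wedge B(y_0,R)=(\eta\mathcal{P}_2)\wedge B(y_0,R)$. They are mutually locally derivable if each is locally derivable from the other. *)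

theory Defs
  imports "HOL-Analysis.Analysis"
begin

section \<open>Abstract pattern spaces\<close>

text \<open>Groups are written additively, so \<open>- g\<close> is the inverse of \<open>g\<close>.  An action on a type or a
  set is a curried function \<open>a g x\<close>.\<close>

definition acts_by_homeomorphisms :: "('g::group_add \<Rightarrow> 'x::topological_space \<Rightarrow> 'x) \<Rightarrow> bool" where
  "acts_by_homeomorphisms a \<longleftrightarrow>
     (\<forall>x. a 0 x = x) \<and> (\<forall>g h x. a (g + h) x = a g (a h x)) \<and> (\<forall>g. continuous_on UNIV (a g))"

record ('p, 'x, 'g) pattern_space =
  patterns :: "'p set"
  cut_off :: "'p \<Rightarrow> 'x set \<Rightarrow> 'p"
  pattern_act :: "'g \<Rightarrow> 'p \<Rightarrow> 'p"

text \<open>\<open>cut_off\<close> is a total function on sets; only its values on closed sets are meaningful.\<close>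

definition abstract_pattern_space ::
    "('g::group_add \<Rightarrow> 'x::topological_space \<Rightarrow> 'x) \<Rightarrow> ('p, 'x, 'g) pattern_space \<Rightarrow> bool" where
  "abstract_pattern_space a S \<longleftrightarrow>
     acts_by_homeomorphisms a \<and>
     patterns S \<noteq> {} \<and>
     (\<forall>P\<in>patterns S. \<forall>C. closed C \<longrightarrow> cut_off S P C \<in> patterns S) \<and>
     (\<forall>P\<in>patterns S. \<forall>g. pattern_act S g P \<in> patterns S) \<and>
     (\<forall>P\<in>patterns S. pattern_act S 0 P = P) \<and>
     (\<forall>P\<in>patterns S. \<forall>g h. pattern_act S (g + h) P = pattern_act S g (pattern_act S h P)) \<and>
     (\<forall>P\<in>patterns S. \<forall>C1 C2. closed C1 \<longrightarrow> closed C2 \<longrightarrow>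
        cut_off S (cut_off S P C1) C2 = cut_off S P (C1 \<inter> C2)) \<and>
     (\<forall>P\<in>patterns S. \<exists>!F. closed F \<and> (\<forall>C. closed C \<longrightarrow> (cut_off S P C = P \<longleftrightarrow> F \<subseteq> C))) \<and>
     (\<forall>P\<in>patterns S. \<forall>g C. closed C \<longrightarrow>
        cut_off S (pattern_act S g P) (a g ` C) = pattern_act S g (cut_off S P C))"

section \<open>Local derivability\<close>

definition locally_derivable_from ::
    "('p, 'x::metric_space, 'g) pattern_space \<Rightarrow> 'p \<Rightarrow> ('q, 'y::metric_space, 'g) pattern_space \<Rightarrow> 'q \<Rightarrow> bool"
  \<comment> \<open>\<open>locally_derivable_from S1 P1 S2 P2\<close>: \<open>P2\<close> is locally derivable from \<open>P1\<close>\<close>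
  where
  "locally_derivable_from S1 P1 S2 P2 \<longleftrightarrow>
     P1 \<in> patterns S1 \<and> P2 \<in> patterns S2 \<and>
     (\<exists>x0 y0 R0. R0 \<ge> 0 \<and>
       (\<forall>g h. \<forall>R\<ge>0.
          cut_off S1 (pattern_act S1 g P1) (cball x0 (R + R0)) =
            cut_off S1 (pattern_act S1 h P1) (cball x0 (R + R0)) \<longrightarrow>
          cut_off S2 (pattern_act S2 g P2) (cball y0 R) =
            cut_off S2 (pattern_act S2 h P2) (cball y0 R)))"

definition mutually_locally_derivable ::
    "('p, 'x::metric_space, 'g) pattern_space \<Rightarrow> 'p \<Rightarrow> ('q, 'y::metric_space, 'g) pattern_space \<Rightarrow> 'q \<Rightarrow> bool" where
  "mutually_locally_derivable S1 P1 S2 P2 \<longleftrightarrow>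
     locally_derivable_from S1 P1 S2 P2 \<and> locally_derivable_from S2 P2 S1 P1"

section \<open>The pattern space of complex-valued maps\<close>

definition fun_act :: "('g::group_add \<Rightarrow> 'x \<Rightarrow> 'x) \<Rightarrow> 'g \<Rightarrow> ('x \<Rightarrow> complex) \<Rightarrow> 'x \<Rightarrow> complex" where
  "fun_act a g f = (\<lambda>x. f (a (- g) x))"

definition Map_space ::
    "('g::group_add \<Rightarrow> 'x \<Rightarrow> 'x) \<Rightarrow> ('x \<Rightarrow> complex, 'x, 'g) pattern_space" where
  "Map_space a =
     \<lparr>patterns = UNIV,
      cut_off = (\<lambda>f C x. if x \<in> C then f x else 0),
      pattern_act = fun_act a\<rparr>"

lemma abstract_pattern_space_Map_space:
  fixes a :: "'g::group_add \<Rightarrow> 'x::topological_space \<Rightarrow> 'x"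
  assumes a: "acts_by_homeomorphisms a"
  shows "abstract_pattern_space a (Map_space a)"
proof -
  have a0: "a 0 x = x" and aplus: "a (g + h) x = a g (a h x)" for g h x
    using a by (auto simp: acts_by_homeomorphisms_def)
  have inv1: "a (- g) (a g x) = x" and inv2: "a g (a (- g) x) = x" for g x
    by (simp_all flip: aplus add: a0)
  have img: "x \<in> a g ` C \<longleftrightarrow> a (- g) x \<in> C" for g x C
    by (metis (no_types, lifting) image_iff inv1 inv2)
  have supp: "\<exists>!F. closed F \<and> (\<forall>C. closed C \<longrightarrow> ((\<lambda>x. if x \<in> C then f x else 0) = f \<longleftrightarrow> F \<subseteq> C))"
    for f :: "'x \<Rightarrow> complex"
  proof -
    have eq: "(\<lambda>x. if x \<in> C then f x else 0) = f \<longleftrightarrow> {x. f x \<noteq> 0} \<subseteq> C" for C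
      by (auto simp: fun_eq_iff)
    show ?thesis
      unfolding eq
    proof (rule ex1I[of _ "closure {x. f x \<noteq> 0}"])
      show "closed (closure {x. f x \<noteq> 0}) \<and>
          (\<forall>C. closed C \<longrightarrow> ({x. f x \<noteq> 0} \<subseteq> C \<longleftrightarrow> closure {x. f x \<noteq> 0} \<subseteq> C))"
        by (meson closed_closure closure_minimal closure_subset order_trans)
    next
      fix F assume "closed F \<and> (\<forall>C. closed C \<longrightarrow> ({x. f x \<noteq> 0} \<subseteq> C \<longleftrightarrow> F \<subseteq> C))"
      then show "F = closure {x. f x \<noteq> 0}"
        by (meson closed_closure closure_minimal closure_subset order_refl subset_antisym)
    qed
  qed
  let ?S = "Map_space a"
  have [simp]: "patterns ?S = UNIV" "cut_off ?S f C = (\<lambda>x. if x \<in> C then f x else 0)"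
    "pattern_act ?S g f = (\<lambda>x. f (a (- g) x))" for f C g
    by (simp_all add: Map_space_def fun_act_def)
  show ?thesis
    unfolding abstract_pattern_space_def
  proof (intro conjI ballI allI impI)
    show "\<exists>!F. closed F \<and> (\<forall>C. closed C \<longrightarrow> (cut_off ?S f C = f \<longleftrightarrow> F \<subseteq> C))" for f
      using supp[of f] by simp
    show "pattern_act ?S (g + h) f = pattern_act ?S g (pattern_act ?S h f)" for f g h
      by (simp add: minus_add aplus del: add_uminus_conv_diff)
  qed (simp_all add: a a0 img fun_eq_iff)
qed

section \<open>Compactly supported continuous functions and their dual\<close>

definition Cc :: "('x::topological_space \<Rightarrow> complex) set" where
  "Cc = {\<phi>. continuous_on UNIV \<phi> \<and> compact (closure {x. \<phi> x \<noteq> 0})}"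

text \<open>A neighbourhood base at \<open>0\<close> of the inductive limit topology: the absolutely convex sets whose
  intersection with each \<open>C\<^sub>K(X) = {\<phi> \<in> C\<^sub>c(X). \<phi> = 0 outside K}\<close>, \<open>K\<close> compact, is a neighbourhood
  of \<open>0\<close> for the supremum norm.\<close>

definition Cc_nbhd0 :: "('x::topological_space \<Rightarrow> complex) set \<Rightarrow> bool" where
  "Cc_nbhd0 V \<longleftrightarrow>
     V \<subseteq> Cc \<and>
     (\<forall>\<phi>\<in>V. \<forall>\<psi>\<in>V. \<forall>c d::complex. norm c + norm d \<le> 1 \<longrightarrow> (\<lambda>x. c * \<phi> x + d * \<psi> x) \<in> V) \<and>
     (\<forall>K. compact K \<longrightarrow> (\<exists>e>0. \<forall>\<phi>\<in>Cc. (\<forall>x. x \<notin> K \<longrightarrow> \<phi> x = 0) \<longrightarrow> (\<forall>x. norm (\<phi> x) \<le> e) \<longrightarrow> \<phi> \<in> V))"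

definition Cc_topology :: "('x::topological_space \<Rightarrow> complex) topology" where
  "Cc_topology = topology (\<lambda>U. U \<subseteq> Cc \<and>
     (\<forall>\<phi>\<in>U. \<exists>V. Cc_nbhd0 V \<and> (\<forall>\<psi>\<in>V. (\<lambda>x. \<phi> x + \<psi> x) \<in> U)))"

text \<open>Functionals on \<open>C\<^sub>c(X)\<close> are extended by \<open>0\<close> to all functions, so that equality of
  functionals on \<open>C\<^sub>c(X)\<close> is HOL equality.\<close>

definition Cc_dual :: "(('x::topological_space \<Rightarrow> complex) \<Rightarrow> complex) set" where
  "Cc_dual = {\<Phi>.
     (\<forall>\<phi>\<in>Cc. \<forall>\<psi>\<in>Cc. \<Phi> (\<lambda>x. \<phi> x + \<psi> x) = \<Phi> \<phi> + \<Phi> \<psi>) \<and>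
     (\<forall>c. \<forall>\<phi>\<in>Cc. \<Phi> (\<lambda>x. c * \<phi> x) = c * \<Phi> \<phi>) \<and>
     continuous_map Cc_topology euclidean \<Phi> \<and>
     (\<forall>\<phi>. \<phi> \<notin> Cc \<longrightarrow> \<Phi> \<phi> = 0)}"

lemma Cc_lincomb:
  assumes "\<phi> \<in> Cc" "\<psi> \<in> Cc"
  shows "(\<lambda>x. c * \<phi> x + d * \<psi> x) \<in> Cc"
proof -
  have "closure {x. c * \<phi> x + d * \<psi> x \<noteq> 0} \<subseteq> closure ({x. \<phi> x \<noteq> 0} \<union> {x. \<psi> x \<noteq> 0})"
    by (rule closure_mono) auto
  then have sub: "closure {x. c * \<phi> x + d * \<psi> x \<noteq> 0} \<subseteq> closure {x. \<phi> x \<noteq> 0} \<union> closure {x. \<psi> x \<noteq> 0}"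
    by simp
  have "compact (closure {x. \<phi> x \<noteq> 0} \<union> closure {x. \<psi> x \<noteq> 0})"
    using assms by (intro compact_Un) (auto simp: Cc_def)
  from compact_Int_closed[OF this closed_closure, of "{x. c * \<phi> x + d * \<psi> x \<noteq> 0}"]
  have "compact (closure {x. c * \<phi> x + d * \<psi> x \<noteq> 0})"
    unfolding Int_absorb1[OF sub] .
  moreover have "continuous_on UNIV (\<lambda>x. c * \<phi> x + d * \<psi> x)"
    using assms by (intro continuous_intros) (auto simp: Cc_def)
  ultimately show ?thesis by (simp add: Cc_def)
qed

lemma Cc_nbhd0_Int: "Cc_nbhd0 V \<Longrightarrow> Cc_nbhd0 W \<Longrightarrow> Cc_nbhd0 (V \<inter> W)"
proof -
  assume V: "Cc_nbhd0 V" and W: "Cc_nbhd0 W"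
  show ?thesis
    unfolding Cc_nbhd0_def
  proof (intro conjI)
    show "V \<inter> W \<subseteq> Cc"
      using V[unfolded Cc_nbhd0_def, THEN conjunct1] by (rule le_infI1)
    show "\<forall>\<phi>\<in>V \<inter> W. \<forall>\<psi>\<in>V \<inter> W. \<forall>c d::complex. norm c + norm d \<le> 1 \<longrightarrow>
        (\<lambda>x. c * \<phi> x + d * \<psi> x) \<in> V \<inter> W"
      using V W unfolding Cc_nbhd0_def by (meson IntD1 IntD2 IntI)
    show "\<forall>K. compact K \<longrightarrow> (\<exists>e>0. \<forall>\<phi>\<in>Cc. (\<forall>x. x \<notin> K \<longrightarrow> \<phi> x = 0) \<longrightarrow>
        (\<forall>x. norm (\<phi> x) \<le> e) \<longrightarrow> \<phi> \<in> V \<inter> W)"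
    proof (intro allI impI)
      fix K :: "'a set" assume K: "compact K"
      obtain e where e: "e > 0" "\<forall>\<phi>\<in>Cc. (\<forall>x. x \<notin> K \<longrightarrow> \<phi> x = 0) \<longrightarrow> (\<forall>x. norm (\<phi> x) \<le> e) \<longrightarrow> \<phi> \<in> V"
        using V K unfolding Cc_nbhd0_def by meson
      obtain d where d: "d > 0" "\<forall>\<phi>\<in>Cc. (\<forall>x. x \<notin> K \<longrightarrow> \<phi> x = 0) \<longrightarrow> (\<forall>x. norm (\<phi> x) \<le> d) \<longrightarrow> \<phi> \<in> W"
        using W K unfolding Cc_nbhd0_def by meson
      show "\<exists>e>0. \<forall>\<phi>\<in>Cc. (\<forall>x. x \<notin> K \<longrightarrow> \<phi> x = 0) \<longrightarrow> (\<forall>x. norm (\<phi> x) \<le> e) \<longrightarrow> \<phi> \<in> V \<inter> W"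
        using e d by (intro exI[of _ "min e d"]) simp
    qed
  qed
qed

lemma openin_Cc_topology:
  "openin Cc_topology U \<longleftrightarrow>
     U \<subseteq> Cc \<and> (\<forall>\<phi>\<in>U. \<exists>V. Cc_nbhd0 V \<and> (\<forall>\<psi>\<in>V. (\<lambda>x. \<phi> x + \<psi> x) \<in> U))"
proof -
  let ?O = "\<lambda>U :: ('a \<Rightarrow> complex) set. U \<subseteq> Cc \<and>
     (\<forall>\<phi>\<in>U. \<exists>V. Cc_nbhd0 V \<and> (\<forall>\<psi>\<in>V. (\<lambda>x. \<phi> x + \<psi> x) \<in> U))"
  have Int: "?O (S \<inter> T)" if "?O S" "?O T" for S T
  proof (intro conjI ballI)
    fix \<phi> assume "\<phi> \<in> S \<inter> T"
    then have "\<phi> \<in> S" "\<phi> \<in> T" by simp_all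
    obtain V where "Cc_nbhd0 V" "\<forall>\<psi>\<in>V. (\<lambda>x. \<phi> x + \<psi> x) \<in> S"
      using \<open>?O S\<close>[THEN conjunct2, rule_format, OF \<open>\<phi> \<in> S\<close>] by (elim exE conjE)
    moreover obtain W where "Cc_nbhd0 W" "\<forall>\<psi>\<in>W. (\<lambda>x. \<phi> x + \<psi> x) \<in> T"
      using \<open>?O T\<close>[THEN conjunct2, rule_format, OF \<open>\<phi> \<in> T\<close>] by (elim exE conjE)
    ultimately show "\<exists>V. Cc_nbhd0 V \<and> (\<forall>\<psi>\<in>V. (\<lambda>x. \<phi> x + \<psi> x) \<in> S \<inter> T)"
      by (intro exI[of _ "V \<inter> W"]) (simp add: Cc_nbhd0_Int)
  qed (use that in blast)
  have Un: "?O (\<Union>\<K>)" if K: "\<forall>K\<in>\<K>. ?O K" for \<K>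
  proof (intro conjI ballI)
    fix \<phi> assume "\<phi> \<in> \<Union>\<K>"
    then obtain K where "K \<in> \<K>" "\<phi> \<in> K" by blast
    then obtain V where "Cc_nbhd0 V" "\<forall>\<psi>\<in>V. (\<lambda>x. \<phi> x + \<psi> x) \<in> K"
      using K by meson
    then show "\<exists>V. Cc_nbhd0 V \<and> (\<forall>\<psi>\<in>V. (\<lambda>x. \<phi> x + \<psi> x) \<in> \<Union>\<K>)"
      using \<open>K \<in> \<K>\<close> by (meson UnionI)
  qed (use K in blast)
  have "istopology ?O"
    unfolding istopology_def
  proof (rule conjI)
    show "\<forall>S T. ?O S \<longrightarrow> ?O T \<longrightarrow> ?O (S \<inter> T)"
      by (intro allI impI Int)
    show "\<forall>\<K>. (\<forall>K\<in>\<K>. ?O K) \<longrightarrow> ?O (\<Union>\<K>)"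
      by (intro allI impI Un)
  qed
  then show ?thesis
    by (simp add: Cc_topology_def topology_inverse')
qed

lemma topspace_Cc_topology: "topspace Cc_topology = Cc"
proof -
  have "Cc_nbhd0 (Cc :: ('a \<Rightarrow> complex) set)"
    unfolding Cc_nbhd0_def by (simp add: Cc_lincomb) (meson zero_less_one)
  moreover have "(\<lambda>x. \<phi> x + \<psi> x) \<in> Cc" if "\<phi> \<in> Cc" "\<psi> \<in> Cc" for \<phi> \<psi> :: "'a \<Rightarrow> complex"
    using Cc_lincomb[OF that, of 1 1] by simp
  ultimately have "openin Cc_topology (Cc :: ('a \<Rightarrow> complex) set)"
    unfolding openin_Cc_topology by blast
  then show ?thesis
    using openin_topspace[of "Cc_topology :: ('a \<Rightarrow> complex) topology", unfolded openin_Cc_topology]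
    by (meson openin_subset subset_antisym)
qed

section \<open>Radon and Haar measures\<close>

definition radon_measure :: "'x::topological_space measure \<Rightarrow> bool" where
  "radon_measure m \<longleftrightarrow>
     sets m = sets borel \<and>
     (\<forall>K. compact K \<longrightarrow> K \<in> sets m \<longrightarrow> emeasure m K < \<infinity>) \<and>
     (\<forall>A\<in>sets m. emeasure m A = (INF U\<in>{U. open U \<and> A \<subseteq> U}. emeasure m U)) \<and>
     (\<forall>U. open U \<longrightarrow> emeasure m U = (SUP K\<in>{K. compact K \<and> K \<in> sets m \<and> K \<subseteq> U}. emeasure m K))"
  \<comment> \<open>in Hausdorff spaces compact sets are Borel, so \<open>K \<in> sets m\<close> is automatic\<close>

definition haar_measure :: "'g::topological_group_add measure \<Rightarrow> bool" where
  "haar_measure m \<longleftrightarrow>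
     radon_measure m \<and> emeasure m UNIV \<noteq> 0 \<and>
     (\<forall>g. \<forall>A\<in>sets m. emeasure m ((\<lambda>x. g + x) ` A) = emeasure m A)"

section \<open>The pattern space of functionals\<close>

text \<open>The functional \<open>u dm\<close> restricted to a set: \<open>\<phi> \<mapsto> \<integral>\<^sub>C \<phi> u dm\<close>.\<close>

definition density_functional_on ::
    "'x::topological_space set \<Rightarrow> 'x measure \<Rightarrow> ('x \<Rightarrow> complex) \<Rightarrow> ('x \<Rightarrow> complex) \<Rightarrow> complex" where
  "density_functional_on C m u = (\<lambda>\<phi>. if \<phi> \<in> Cc then (LINT x:C|m. \<phi> x * u x) else 0)"

abbreviation density_functional ::
    "'x::topological_space measure \<Rightarrow> ('x \<Rightarrow> complex) \<Rightarrow> ('x \<Rightarrow> complex) \<Rightarrow> complex" where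
  "density_functional \<equiv> density_functional_on UNIV"

definition polar_representation ::
    "(('x::topological_space \<Rightarrow> complex) \<Rightarrow> complex) \<Rightarrow> 'x measure \<Rightarrow> ('x \<Rightarrow> complex) \<Rightarrow> bool" where
  "polar_representation \<Phi> m u \<longleftrightarrow>
     radon_measure m \<and> u \<in> borel_measurable borel \<and> (\<forall>x. norm (u x) = 1) \<and>
     \<Phi> = density_functional m u"

text \<open>By the Riesz representation theorem every element of the dual has a polar representation
  \<open>(m, u)\<close>, with \<open>m\<close> unique and \<open>u\<close> unique almost everywhere; hence the description below
  determines the cut-off functional.\<close>

definition functional_cut_off ::
    "(('x::topological_space \<Rightarrow> complex) \<Rightarrow> complex) \<Rightarrow> 'x set \<Rightarrow> ('x \<Rightarrow> complex) \<Rightarrow> complex" where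
  "functional_cut_off \<Phi> C =
     (THE \<Psi>. \<exists>m u. polar_representation \<Phi> m u \<and> \<Psi> = density_functional_on C m u)"

definition Cc_dual_space ::
    "('g::group_add \<Rightarrow> 'x::topological_space \<Rightarrow> 'x) \<Rightarrow> (('x \<Rightarrow> complex) \<Rightarrow> complex, 'x, 'g) pattern_space" where
  "Cc_dual_space a =
     \<lparr>patterns = Cc_dual,
      cut_off = functional_cut_off,
      pattern_act = (\<lambda>g \<Phi> \<phi>. \<Phi> (fun_act a (- g) \<phi>))\<rparr>"

section \<open>Metric groups\<close>

definition proper_metric :: "'x::metric_space itself \<Rightarrow> bool" where
  "proper_metric _ \<longleftrightarrow> (\<forall>(x::'x) r. compact (cball x r))"

definition translation_invariant_metric :: "'g::{group_add, metric_space} itself \<Rightarrow> bool" where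
  "translation_invariant_metric _ \<longleftrightarrow>
     (\<forall>g x y :: 'g. dist (g + x) (g + y) = dist x y \<and> dist (x + g) (y + g) = dist x y)"

definition sigma_compact :: "'x::topological_space set \<Rightarrow> bool" where
  "sigma_compact S \<longleftrightarrow> (\<exists>K::nat \<Rightarrow> 'x set. (\<forall>n. compact (K n)) \<and> (\<Union>n. K n) = S)"

end

theory Submission
  imports Defs
begin

text \<open>
  Both derivability statements take the base points \<open>x\<^sub>0 = y\<^sub>0 = 0\<close> and rest on two computations
  in \<open>C\<^sub>c(\<Gamma>)\<^sup>*\<close>. Translation invariance of \<open>\<mu>\<close> shows that translating \<open>f d\<mu>\<close> by \<open>\<gamma>\<close> gives
  \<open>(\<gamma>f) d\<mu>\<close> (\<open>pattern_act_density_functional\<close>). Cutting \<open>f d\<mu>\<close> off at a closed set \<open>C\<close> gives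
  \<open>\<phi> \<mapsto> \<integral>\<^sub>C \<phi> f d\<mu>\<close> (\<open>functional_cut_off_density_functional\<close>).

  The second computation is the main work, since the cut-off is defined through polar representations
  with a unimodular density. Such a representation exists: take the measure \<open>|f| d\<mu>\<close> and the
  density \<open>f / |f|\<close>; that \<open>|f| d\<mu>\<close> is again a Radon measure uses that \<open>f\<close> is bounded and the
  metric is proper. All representations give the same cut-off: a functional determines its
  restriction to a closed set, because the indicator of \<open>C\<close> is the decreasing limit of the
  continuous functions \<open>max 0 (1 - n d(x, C))\<close>, which act on \<open>C\<^sub>c(\<Gamma>)\<close> by multiplication. This
  dominated-convergence argument replaces uniqueness in the Riesz representation theorem.

  Given these facts, functions that agree on a ball have the same restricted functional on it, so
  \<open>f d\<mu>\<close> is derivable from \<open>f\<close> with \<open>R\<^sub>0 = 0\<close>. Conversely, if the restrictions of two functionals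
  to the ball of radius \<open>R + 1\<close> agree, test functions supported in a ball of radius \<open>1\<close> about a point
  \<open>x\<close> of the ball of radius \<open>R\<close> do not see the cut-off; as \<open>\<mu>\<close> charges every ball, the continuous
  densities agree at \<open>x\<close> (\<open>density_functional_on_cball_eqD\<close>). So \<open>f\<close> is derivable from \<open>f d\<mu>\<close> with
  \<open>R\<^sub>0 = 1\<close>.
\<close>

section \<open>Compactly supported continuous functions\<close>

lemma CcI:
  fixes \<phi> :: "'x::t2_space \<Rightarrow> complex"
  assumes "continuous_on UNIV \<phi>" "compact K" "\<And>x. x \<notin> K \<Longrightarrow> \<phi> x = 0"
  shows "\<phi> \<in> Cc"
proof -
  have "closure {x. \<phi> x \<noteq> 0} \<subseteq> K"
    using assms by (intro closure_minimal compact_imp_closed) auto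
  then show ?thesis
    using assms compact_Int_closed[OF assms(2) closed_closure, of "{x. \<phi> x \<noteq> 0}"]
    by (simp add: Cc_def Int_absorb1)
qed

lemma CcE:
  fixes \<phi> :: "'x::t2_space \<Rightarrow> complex"
  assumes "\<phi> \<in> Cc"
  obtains K B where "continuous_on UNIV \<phi>" "compact K" "\<And>x. x \<notin> K \<Longrightarrow> \<phi> x = 0"
    "B \<ge> 0" "\<And>x. norm (\<phi> x) \<le> B"
proof -
  let ?K = "closure {x. \<phi> x \<noteq> 0}"
  have c: "continuous_on UNIV \<phi>" and K: "compact ?K"
    using assms by (auto simp: Cc_def)
  have 0: "\<phi> x = 0" if "x \<notin> ?K" for x
    using that closure_subset[of "{x. \<phi> x \<noteq> 0}"] by auto
  have "compact (\<phi> ` ?K)"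
    using c K by (meson compact_continuous_image continuous_on_subset subset_UNIV)
  then obtain B where B: "\<And>x. x \<in> ?K \<Longrightarrow> norm (\<phi> x) \<le> B"
    using compact_imp_bounded[of "\<phi> ` ?K"] unfolding bounded_iff by blast
  have "norm (\<phi> x) \<le> max 0 B" for x
  proof (cases "x \<in> ?K")
    case True
    show ?thesis using B[OF True] by linarith
  next
    case False
    show ?thesis unfolding 0[OF False] by simp
  qed
  from c K 0 max.cobounded1 this show ?thesis
    by (rule that)
qed

lemma Cc_mult_continuous:
  fixes \<phi> \<psi> :: "'x::t2_space \<Rightarrow> complex"
  assumes "\<phi> \<in> Cc" "continuous_on UNIV \<psi>"
  shows "(\<lambda>x. \<psi> x * \<phi> x) \<in> Cc"
  using assms(1)
proof (rule CcE)
  fix K assume "continuous_on UNIV \<phi>" "compact K" "\<And>x. x \<notin> K \<Longrightarrow> \<phi> x = 0"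
  then show ?thesis
    using assms(2) by (intro CcI[of _ K] continuous_intros) auto
qed

lemma Cc_translate:
  fixes \<phi> :: "'g::{topological_group_add, t2_space} \<Rightarrow> complex"
  assumes "\<phi> \<in> Cc"
  shows "(\<lambda>x. \<phi> (g + x)) \<in> Cc"
  using assms
proof (rule CcE)
  fix K assume \<phi>: "continuous_on UNIV \<phi>" and K: "compact K" and 0: "\<And>x. x \<notin> K \<Longrightarrow> \<phi> x = 0"
  show ?thesis
  proof (rule CcI)
    show "continuous_on UNIV (\<lambda>x. \<phi> (g + x))"
      by (rule continuous_on_compose2[OF \<phi>]) (auto intro!: continuous_intros)
    show "compact ((\<lambda>x. - g + x) ` K)"
      by (rule compact_continuous_image[OF _ K]) (auto intro!: continuous_intros)
    show "\<phi> (g + x) = 0" if "x \<notin> (\<lambda>x. - g + x) ` K" for x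
      using that image_eqI[of x "\<lambda>x. - g + x" "g + x" K] by (intro 0) auto
  qed
qed

lemma Cc_translate_iff:
  fixes \<phi> :: "'g::{topological_group_add, t2_space} \<Rightarrow> complex"
  shows "(\<lambda>x. \<phi> (g + x)) \<in> Cc \<longleftrightarrow> \<phi> \<in> Cc"
  using Cc_translate[of \<phi> g] Cc_translate[of "\<lambda>x. \<phi> (g + x)" "- g"]
  by auto

section \<open>Integration against Radon measures\<close>

lemma radon_measure_sets: "radon_measure m \<Longrightarrow> sets m = sets borel"
  by (simp add: radon_measure_def)

lemma radon_measure_space: "radon_measure m \<Longrightarrow> space m = UNIV"
  using sets_eq_imp_space_eq[OF radon_measure_sets] by simp

lemma radon_measure_compact:
  fixes m :: "'x::t2_space measure"
  assumes "radon_measure m" "compact K"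
  shows "K \<in> sets m" "emeasure m K < \<infinity>"
proof -
  show K: "K \<in> sets m"
    using radon_measure_sets[OF assms(1)] compact_imp_closed[OF assms(2)] by simp
  show "emeasure m K < \<infinity>"
    using assms K unfolding radon_measure_def by meson
qed

lemma radon_measure_borel_measurable:
  assumes "radon_measure m" "u \<in> borel_measurable borel"
  shows "u \<in> borel_measurable m"
  using assms(2) by (simp only: measurable_cong_sets[OF radon_measure_sets[OF assms(1)] refl])

text \<open>Every integral in a density functional is of this kind: \<open>\<phi>\<close> is bounded and lives on a compact
  set, and a Radon measure is finite there.\<close>

lemma integrable_Cc_times_bounded:
  fixes m :: "'x::t2_space measure"
  assumes m: "radon_measure m" and \<phi>: "\<phi> \<in> Cc"
    and u: "u \<in> borel_measurable borel" and uB: "\<And>x. norm (u x) \<le> B"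
  shows "integrable m (\<lambda>x. \<phi> x * u x)"
  using \<phi>
proof (rule CcE)
  fix K D assume c: "continuous_on UNIV \<phi>" and K: "compact K" and 0: "\<And>x. x \<notin> K \<Longrightarrow> \<phi> x = 0"
    and D: "D \<ge> 0" "\<And>x. norm (\<phi> x) \<le> D"
  note \<phi>_meas = borel_measurable_continuous_onI[OF c]
  show ?thesis
  proof (rule integrableI_bounded_set)
    show "K \<in> sets m" "emeasure m K < \<infinity>"
      using radon_measure_compact[OF m K] by auto
    show "(\<lambda>x. \<phi> x * u x) \<in> borel_measurable m"
      using \<phi>_meas u by (intro radon_measure_borel_measurable[OF m]) measurable
    show "AE x in m. x \<in> K \<longrightarrow> norm (\<phi> x * u x) \<le> D * B"
      using D uB by (auto simp: norm_mult intro!: mult_mono AE_I2)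
    show "AE x in m. x \<notin> K \<longrightarrow> \<phi> x * u x = 0"
      using 0 by auto
  qed
qed

lemma density_functional_on_UNIV:
  "radon_measure m \<Longrightarrow> \<phi> \<in> Cc \<Longrightarrow> density_functional m u \<phi> = (LINT x|m. \<phi> x * u x)"
  by (simp add: density_functional_on_def set_lebesgue_integral_def)

text \<open>On functions supported in a compact set \<open>K\<close> the functional is bounded by \<open>m(K) B\<close> times the
  supremum norm, so the sublevel sets of its modulus are basic neighbourhoods of zero for the
  inductive limit topology.\<close>

lemma density_functional_in_Cc_dual:
  fixes m :: "'x::t2_space measure"
  assumes m: "radon_measure m"
    and u: "u \<in> borel_measurable borel" and uB: "\<And>x. norm (u x) \<le> B"
  shows "density_functional m u \<in> Cc_dual"
proof -
  let ?\<Phi> = "density_functional m u"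
  note int = integrable_Cc_times_bounded[OF m _ u uB]
  have lin: "?\<Phi> (\<lambda>x. c * \<phi> x + d * \<psi> x) = c * ?\<Phi> \<phi> + d * ?\<Phi> \<psi>"
    if "\<phi> \<in> Cc" "\<psi> \<in> Cc" for \<phi> \<psi> c d
    using that int[OF that(1)] int[OF that(2)]
    by (simp add: density_functional_on_UNIV[OF m] Cc_lincomb distrib_right mult.assoc)
  have "B \<ge> 0"
    using norm_ge_zero uB order_trans by blast
  have nbhd: "Cc_nbhd0 {\<psi> \<in> Cc. norm (?\<Phi> \<psi>) < e}" if "e > 0" for e
    unfolding Cc_nbhd0_def
  proof (intro conjI ballI allI impI)
    fix \<phi> \<psi> and c d :: complex
    assume \<phi>: "\<phi> \<in> {\<psi> \<in> Cc. norm (?\<Phi> \<psi>) < e}" and \<psi>: "\<psi> \<in> {\<psi> \<in> Cc. norm (?\<Phi> \<psi>) < e}"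
      and cd: "norm c + norm d \<le> 1"
    \<comment> \<open>the maximum keeps the bound strictly below \<open>e\<close> also when \<open>c = d = 0\<close>\<close>
    define s where "s = max (norm (?\<Phi> \<phi>)) (norm (?\<Phi> \<psi>))"
    have s: "s < e" "0 \<le> s" "norm (?\<Phi> \<phi>) \<le> s" "norm (?\<Phi> \<psi>) \<le> s"
      using \<phi> \<psi> by (auto simp: s_def le_max_iff_disj)
    have "norm (c * ?\<Phi> \<phi> + d * ?\<Phi> \<psi>) \<le> norm c * s + norm d * s"
      using s by (intro norm_triangle_le add_mono) (auto simp: norm_mult intro!: mult_left_mono)
    also have "\<dots> = (norm c + norm d) * s" by (simp add: algebra_simps)
    also have "\<dots> \<le> 1 * s" using cd s by (intro mult_right_mono) auto
    finally have "norm (c * ?\<Phi> \<phi> + d * ?\<Phi> \<psi>) < e" using s by simp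
    with \<phi> \<psi> show "(\<lambda>x. c * \<phi> x + d * \<psi> x) \<in> {\<psi> \<in> Cc. norm (?\<Phi> \<psi>) < e}"
      by (simp add: Cc_lincomb lin)
  next
    fix K :: "'x set" assume K: "compact K"
    note Km = radon_measure_compact[OF m K]
    define M where "M = measure m K * B"
    have "M \<ge> 0" using \<open>B \<ge> 0\<close> by (simp add: M_def)
    \<comment> \<open>chosen so that \<open>\<delta> M < e\<close>, including the case \<open>M = 0\<close>\<close>
    define \<delta> where "\<delta> = e / (2 * (M + 1))"
    have "\<delta> > 0" using \<open>M \<ge> 0\<close> \<open>e > 0\<close> by (simp add: \<delta>_def)
    have "norm (?\<Phi> \<phi>) < e"
      if \<phi>: "\<phi> \<in> Cc" "\<forall>x. x \<notin> K \<longrightarrow> \<phi> x = 0" "\<forall>x. norm (\<phi> x) \<le> \<delta>" for \<phi>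
    proof -
      have "norm (?\<Phi> \<phi>) \<le> (LINT x|m. norm (\<phi> x * u x))"
        unfolding density_functional_on_UNIV[OF m \<phi>(1)] by (rule integral_norm_bound)
      also have "\<dots> \<le> (LINT x|m. \<delta> * B * indicator K x)"
      proof (rule Bochner_Integration.integral_mono[OF integrable_norm[OF int[OF \<phi>(1)]]])
        show "integrable m (\<lambda>x. \<delta> * B * indicator K x)"
          using Km by (intro integrable_mult_right integrable_real_indicator)
        show "norm (\<phi> x * u x) \<le> \<delta> * B * indicator K x" for x
          using \<phi> uB[of x] \<open>\<delta> > 0\<close> by (cases "x \<in> K") (auto simp: norm_mult intro!: mult_mono)
      qed
      also have "\<dots> = \<delta> * M"
        using Km by (simp add: M_def radon_measure_space[OF m])
      also have "\<dots> < e"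
        using \<open>M \<ge> 0\<close> \<open>e > 0\<close> by (simp add: \<delta>_def field_simps add_strict_increasing2)
      finally show ?thesis .
    qed
    with \<open>\<delta> > 0\<close> show "\<exists>\<delta>>0. \<forall>\<phi>\<in>Cc. (\<forall>x. x \<notin> K \<longrightarrow> \<phi> x = 0) \<longrightarrow> (\<forall>x. norm (\<phi> x) \<le> \<delta>) \<longrightarrow>
        \<phi> \<in> {\<psi> \<in> Cc. norm (?\<Phi> \<psi>) < e}"
      by blast
  qed auto
  have add: "?\<Phi> (\<lambda>x. \<phi> x + \<psi> x) = ?\<Phi> \<phi> + ?\<Phi> \<psi>" if "\<phi> \<in> Cc" "\<psi> \<in> Cc" for \<phi> \<psi>
    using lin[OF that, of 1 1] by simp
  have "continuous_map Cc_topology euclidean ?\<Phi>"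
    unfolding continuous_map_def topspace_Cc_topology
  proof (intro conjI allI impI)
    fix V :: "complex set" assume "openin euclidean V"
    then have "open V" by simp
    show "openin Cc_topology {\<phi> \<in> Cc. ?\<Phi> \<phi> \<in> V}"
      unfolding openin_Cc_topology
    proof (intro conjI ballI)
      fix \<phi> assume \<phi>: "\<phi> \<in> {\<phi> \<in> Cc. ?\<Phi> \<phi> \<in> V}"
      then obtain e where "e > 0" and e: "\<And>z. dist z (?\<Phi> \<phi>) < e \<Longrightarrow> z \<in> V"
        using \<open>open V\<close> unfolding open_dist by blast
      have "(\<lambda>x. \<phi> x + \<psi> x) \<in> {\<phi> \<in> Cc. ?\<Phi> \<phi> \<in> V}" if "\<psi> \<in> {\<psi> \<in> Cc. norm (?\<Phi> \<psi>) < e}" for \<psi>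
        using that \<phi> Cc_lincomb[of \<phi> \<psi> 1 1] by (auto simp: add dist_norm intro!: e)
      with nbhd[OF \<open>e > 0\<close>] show "\<exists>W. Cc_nbhd0 W \<and> (\<forall>\<psi>\<in>W. (\<lambda>x. \<phi> x + \<psi> x) \<in> {\<phi> \<in> Cc. ?\<Phi> \<phi> \<in> V})"
        by blast
    qed auto
  qed auto
  moreover have "?\<Phi> (\<lambda>x. c * \<phi> x) = c * ?\<Phi> \<phi>" if "\<phi> \<in> Cc" for c \<phi>
    using lin[OF that that, of c 0] by simp
  ultimately show ?thesis
    by (simp add: Cc_dual_def add) (simp add: density_functional_on_def)
qed

section \<open>Cutting off a functional with bounded density\<close>

text \<open>The restriction to a closed set is recovered from the values of the functional on \<open>C\<^sub>c(X)\<close>, with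
  no reference to the representing measure: the cut-off functions decrease to the indicator of \<open>C\<close>
  because \<open>d(x, C) > 0\<close> off the closed set \<open>C\<close>, and \<open>|\<phi> u|\<close> dominates. Nonemptiness excludes the
  default value \<open>infdist x {} = 0\<close>.\<close>

lemma density_functional_on_limit:
  fixes m :: "'x::metric_space measure"
  assumes m: "radon_measure m"
    and u: "u \<in> borel_measurable borel" and uB: "\<And>x. norm (u x) \<le> B"
    and C: "closed C" "C \<noteq> {}" and \<phi>: "\<phi> \<in> Cc"
  shows "(\<lambda>n. density_functional m u (\<lambda>x. of_real (max 0 (1 - real n * infdist x C)) * \<phi> x))
           \<longlonglongrightarrow> density_functional_on C m u \<phi>"
proof -
  let ?\<psi> = "\<lambda>n x. max 0 (1 - real n * infdist x C)"
  have cont: "continuous_on UNIV (?\<psi> n)" for n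
    by (intro continuous_intros)
  have Cc: "(\<lambda>x. of_real (?\<psi> n x) * \<phi> x) \<in> Cc" for n
    by (intro Cc_mult_continuous[OF \<phi>] continuous_intros)
  have \<phi>_meas: "\<phi> \<in> borel_measurable borel"
    using \<phi> by (auto simp: Cc_def intro!: borel_measurable_continuous_onI)
  have int: "integrable m (\<lambda>x. \<phi> x * u x)"
    by (rule integrable_Cc_times_bounded[OF m \<phi> u uB])
  have lim: "(\<lambda>n. ?\<psi> n x) \<longlonglongrightarrow> indicator C x" for x
  proof (cases "x \<in> C")
    case True
    then show ?thesis by simp
  next
    case False
    then have pos: "infdist x C > 0"
      using C by (simp add: in_closed_iff_infdist_zero less_le infdist_nonneg)
    then obtain N :: nat where N: "1 < real N * infdist x C"
      using reals_Archimedean3 by blast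
    have "?\<psi> n x = 0" if "n \<ge> N" for n
    proof -
      have "real N * infdist x C \<le> real n * infdist x C"
        using that pos by (intro mult_right_mono) auto
      with N show ?thesis by (intro max_absorb1) linarith
    qed
    then show ?thesis
      using False by (intro tendsto_eventually) (auto simp: eventually_sequentially)
  qed
  have "(\<lambda>n. LINT x|m. ?\<psi> n x *\<^sub>R (\<phi> x * u x)) \<longlonglongrightarrow> (LINT x|m. indicator C x *\<^sub>R (\<phi> x * u x))"
  proof (rule integral_dominated_convergence[where w = "\<lambda>x. norm (\<phi> x * u x)"])
    show "(\<lambda>x. indicator C x *\<^sub>R (\<phi> x * u x)) \<in> borel_measurable m"
      using \<phi>_meas u C by (intro radon_measure_borel_measurable[OF m]) measurable
    show "(\<lambda>x. ?\<psi> n x *\<^sub>R (\<phi> x * u x)) \<in> borel_measurable m" for n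
      by (intro radon_measure_borel_measurable[OF m] borel_measurable_scaleR borel_measurable_times
          \<phi>_meas u borel_measurable_continuous_onI[OF cont])
    show "integrable m (\<lambda>x. norm (\<phi> x * u x))"
      using int by simp
    show "AE x in m. (\<lambda>n. ?\<psi> n x *\<^sub>R (\<phi> x * u x)) \<longlonglongrightarrow> indicator C x *\<^sub>R (\<phi> x * u x)"
      by (intro AE_I2 tendsto_scaleR lim tendsto_const)
    show "AE x in m. norm (?\<psi> n x *\<^sub>R (\<phi> x * u x)) \<le> norm (\<phi> x * u x)" for n
      by (intro AE_I2) (auto simp: infdist_nonneg intro!: mult_left_le_one_le)
  qed
  then show ?thesis
    unfolding density_functional_on_UNIV[OF m Cc]
    by (simp add: density_functional_on_def \<phi> set_lebesgue_integral_def scaleR_conv_of_real mult.assoc)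
qed

text \<open>Hence the cut-off does not depend on the measure and density that represent the functional.\<close>

lemma density_functional_on_cong:
  fixes m m' :: "'x::metric_space measure"
  assumes m: "radon_measure m" "u \<in> borel_measurable borel" "\<And>x. norm (u x) \<le> B"
    and m': "radon_measure m'" "u' \<in> borel_measurable borel" "\<And>x. norm (u' x) \<le> B'"
    and eq: "density_functional m u = density_functional m' u'" and C: "closed C"
  shows "density_functional_on C m u = density_functional_on C m' u'"
proof
  fix \<phi> :: "'x \<Rightarrow> complex"
  consider "\<phi> \<notin> Cc \<or> C = {}" | "\<phi> \<in> Cc" "C \<noteq> {}" by blast
  then show "density_functional_on C m u \<phi> = density_functional_on C m' u' \<phi>"
  proof cases
    case 1
    then show ?thesis by (auto simp: density_functional_on_def set_lebesgue_integral_def)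
  next
    case 2
    show ?thesis
      using density_functional_on_limit[OF m C 2(2,1)] density_functional_on_limit[OF m' C 2(2,1)]
      unfolding eq by (rule LIMSEQ_unique)
  qed
qed

text \<open>The points of a large closed ball with distance at least \<open>1 / n\<close> from the complement form a
  compact set. This exhaustion gives inner regularity on open sets by continuity from below.\<close>

lemma proper_open_sigma_compact:
  fixes U :: "'x::metric_space set"
  assumes "proper_metric TYPE('x)" and U: "open U"
  obtains K :: "nat \<Rightarrow> 'x set" where "\<And>n. compact (K n)" "incseq K" "(\<Union>n. K n) = U"
proof (cases "U = UNIV")
  \<comment> \<open>separate because the distance to the empty complement is \<open>0\<close> by convention\<close>
  case True
  fix z :: 'x
  show ?thesis
  proof (rule that[of "\<lambda>n. cball z (real n)"])
    show "(\<Union>n. cball z (real n)) = U"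
      using True real_arch_simple by auto
  qed (use assms in \<open>auto simp: proper_metric_def incseq_def\<close>)
next
  case False
  fix z :: 'x
  let ?K = "\<lambda>n. cball z (real n) \<inter> {x. 1 \<le> real n * infdist x (- U)}"
  show ?thesis
  proof (rule that[of ?K])
    show "compact (?K n)" for n
    proof (rule compact_Int_closed)
      show "compact (cball z (real n))"
        using assms by (auto simp: proper_metric_def)
      show "closed {x. 1 \<le> real n * infdist x (- U)}"
        by (intro closed_Collect_le continuous_intros)
    qed
    show "incseq ?K"
      unfolding incseq_def
    proof (intro allI impI subsetI)
      fix i j :: nat and x assume "i \<le> j" and x: "x \<in> ?K i"
      then show "x \<in> ?K j"
        using mult_right_mono[of "real i" "real j" "infdist x (- U)"] by (auto simp: infdist_nonneg)
    qed
    show "(\<Union>n. ?K n) = U"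
    proof (intro equalityI subsetI)
      fix x assume "x \<in> (\<Union>n. ?K n)"
      then obtain n where "1 \<le> real n * infdist x (- U)" by auto
      then show "x \<in> U" by (cases "x \<in> U") auto
    next
      fix x assume "x \<in> U"
      then have pos: "infdist x (- U) > 0"
        using False U in_closed_iff_infdist_zero[of "- U" x] by (auto simp: less_le infdist_nonneg)
      then obtain N :: nat where N: "1 < real N * infdist x (- U)"
        using reals_Archimedean3 by blast
      obtain M :: nat where M: "dist z x \<le> real M"
        using real_arch_simple by blast
      have "real N * infdist x (- U) \<le> real (max N M) * infdist x (- U)"
        using pos by (intro mult_right_mono) auto
      then have "x \<in> ?K (max N M)"
        using N M by (simp add: le_max_iff_disj)
      then show "x \<in> (\<Union>n. ?K n)" by blast
    qed
  qed
qed

text \<open>Only outer regularity needs an idea. A Borel set may have infinite measure, so it is cut into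
  pieces \<open>A \<inter> B(z, n)\<close> of finite measure; each has an open neighbourhood whose excess is small
  for \<open>m\<close>, hence small for the new measure by boundedness of the density, and the excesses are made
  summable.\<close>

lemma radon_measure_density:
  fixes m :: "'x::metric_space measure"
  assumes proper: "proper_metric TYPE('x)" and m: "radon_measure m"
    and g: "g \<in> borel_measurable borel" and gB: "\<And>x. g x \<le> B"
  shows "radon_measure (density m (\<lambda>x. ennreal (g x)))"
proof -
  let ?d = "density m (\<lambda>x. ennreal (g x))"
  have [measurable_cong, simp]: "sets m = sets borel"
    by (rule radon_measure_sets[OF m])
  \<comment> \<open>a strictly positive bound, since it is divided by below\<close>
  define b where "b = max B 0 + 1"
  have "b > 0" by (simp add: b_def)
  have [measurable]: "g \<in> borel_measurable m"
    by (rule radon_measure_borel_measurable[OF m g])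
  have le: "emeasure ?d A \<le> ennreal b * emeasure m A" if [measurable]: "A \<in> sets borel" for A
  proof -
    have "emeasure ?d A = (\<integral>\<^sup>+ x. ennreal (g x) * indicator A x \<partial>m)"
      by (rule emeasure_density) auto
    also have "\<dots> \<le> (\<integral>\<^sup>+ x. ennreal b * indicator A x \<partial>m)"
    proof (intro nn_integral_mono mult_right_mono ennreal_leI)
      show "g x \<le> b" for x using gB[of x] by (simp add: b_def)
    qed auto
    finally show ?thesis by (simp add: nn_integral_cmult_indicator)
  qed
  show ?thesis
    unfolding radon_measure_def
  proof (intro conjI allI impI ballI)
    show "sets ?d = sets borel" by simp
  next
    fix K :: "'x set" assume K: "compact K"
    show "emeasure ?d K < \<infinity>"
    proof (rule le_less_trans)
      show "emeasure ?d K \<le> ennreal b * emeasure m K"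
        using radon_measure_compact[OF m K] by (intro le) simp
      show "ennreal b * emeasure m K < \<infinity>"
        using radon_measure_compact[OF m K] by (simp add: ennreal_mult_less_top)
    qed
  next
    fix A assume "A \<in> sets ?d"
    then have A[measurable]: "A \<in> sets borel" by simp
    fix z :: 'x
    show "emeasure ?d A = (INF U\<in>{U. open U \<and> A \<subseteq> U}. emeasure ?d U)"
    proof (rule antisym)
      show "emeasure ?d A \<le> (INF U\<in>{U. open U \<and> A \<subseteq> U}. emeasure ?d U)"
        by (intro INF_greatest emeasure_mono) auto
      show "(INF U\<in>{U. open U \<and> A \<subseteq> U}. emeasure ?d U) \<le> emeasure ?d A"
      proof (rule ennreal_le_epsilon)
        fix e :: real assume "e > 0"
        define \<delta> where "\<delta> n = e * (1/2) ^ Suc n" for n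
        have \<delta>: "\<delta> n > 0" for n using \<open>e > 0\<close> by (simp add: \<delta>_def)
        let ?A = "\<lambda>n::nat. A \<inter> cball z (real n)"
        have "\<exists>U. open U \<and> ?A n \<subseteq> U \<and> emeasure m (U - ?A n) \<le> ennreal (\<delta> n / b)" for n
        proof -
          have "compact (cball z (real n))" using proper by (auto simp: proper_metric_def)
          then have fin: "emeasure m (?A n) < \<infinity>"
            using radon_measure_compact[OF m] emeasure_mono[of "?A n" "cball z (real n)" m]
            by (auto intro: le_less_trans)
          have "(INF U\<in>{U. open U \<and> ?A n \<subseteq> U}. emeasure m U) = emeasure m (?A n)"
            using m by (simp add: radon_measure_def)
          also have "\<dots> < emeasure m (?A n) + ennreal (\<delta> n / b)"
            using fin \<delta>[of n] \<open>b > 0\<close> by (auto simp: ennreal_add_left_cancel_less intro!: ennreal_less_zero_iff[THEN iffD2])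
          finally obtain U where U: "open U" "?A n \<subseteq> U"
              "emeasure m U < emeasure m (?A n) + ennreal (\<delta> n / b)"
            by (auto simp: INF_less_iff)
          have "emeasure m (U - ?A n) = emeasure m U - emeasure m (?A n)"
            using U fin by (intro emeasure_Diff) auto
          also have "\<dots> \<le> ennreal (\<delta> n / b)"
            using U(3) fin by (auto simp: ennreal_minus_le_iff less_imp_le)
          finally show ?thesis using U by blast
        qed
        then obtain U where U: "\<And>n. open (U n)" "\<And>n. ?A n \<subseteq> U n"
            "\<And>n. emeasure m (U n - ?A n) \<le> ennreal (\<delta> n / b)"
          by metis
        have [measurable]: "U n \<in> sets borel" for n using U by auto
        have "A \<subseteq> (\<Union>n. U n)"
        proof
          fix x assume "x \<in> A"
          obtain n :: nat where "dist z x \<le> real n" using real_arch_simple by blast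
          with \<open>x \<in> A\<close> U(2)[of n] show "x \<in> (\<Union>n. U n)" by auto
        qed
        then have "(INF U\<in>{U. open U \<and> A \<subseteq> U}. emeasure ?d U) \<le> emeasure ?d (\<Union>n. U n)"
          using U by (intro INF_lower) auto
        also have "\<dots> \<le> emeasure ?d (A \<union> (\<Union>n. U n - ?A n))"
          by (intro emeasure_mono) auto
        also have "\<dots> \<le> emeasure ?d A + emeasure ?d (\<Union>n. U n - ?A n)"
          by (intro emeasure_subadditive) auto
        also have "emeasure ?d (\<Union>n. U n - ?A n) \<le> (\<Sum>n. emeasure ?d (U n - ?A n))"
          by (intro emeasure_subadditive_countably) auto
        also have "\<dots> \<le> (\<Sum>n. ennreal (\<delta> n))"
        proof (intro suminf_le summableI)
          fix n
          have "emeasure ?d (U n - ?A n) \<le> ennreal b * emeasure m (U n - ?A n)"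
            by (intro le) auto
          also have "\<dots> \<le> ennreal b * ennreal (\<delta> n / b)"
            using U by (intro mult_left_mono) auto
          also have "\<dots> = ennreal (\<delta> n)"
            using \<open>b > 0\<close> \<delta>[of n] by (simp flip: ennreal_mult)
          finally show "emeasure ?d (U n - ?A n) \<le> ennreal (\<delta> n)" .
        qed
        also have "(\<Sum>n. ennreal (\<delta> n)) = ennreal e"
          using sums_mult[OF power_half_series, of e] \<delta>
          by (intro suminf_ennreal_eq) (auto simp: \<delta>_def less_imp_le)
        finally show "(INF U\<in>{U. open U \<and> A \<subseteq> U}. emeasure ?d U) \<le> emeasure ?d A + ennreal e"
          by (simp add: add_left_mono)
      qed
    qed
  next
    fix U :: "'x set" assume "open U"
    obtain K :: "nat \<Rightarrow> 'x set" where K: "\<And>n. compact (K n)" "incseq K" "(\<Union>n. K n) = U"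
      using proper_open_sigma_compact[OF proper \<open>open U\<close>] by metis
    have Km: "K n \<in> sets borel" for n
      by (intro borel_closed compact_imp_closed K(1))
    show "emeasure ?d U = (SUP K\<in>{K. compact K \<and> K \<in> sets ?d \<and> K \<subseteq> U}. emeasure ?d K)"
    proof (rule antisym)
      have "emeasure ?d U = (SUP n. emeasure ?d (K n))"
        using SUP_emeasure_incseq[of K ?d] K(2,3) Km by (simp add: image_subset_iff)
      also have "\<dots> \<le> (SUP K\<in>{K. compact K \<and> K \<in> sets ?d \<and> K \<subseteq> U}. emeasure ?d K)"
        using K Km by (intro SUP_least SUP_upper) auto
      finally show "emeasure ?d U \<le> \<dots>" .
      show "(SUP K\<in>{K. compact K \<and> K \<in> sets ?d \<and> K \<subseteq> U}. emeasure ?d K) \<le> emeasure ?d U"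
        using \<open>open U\<close> by (intro SUP_least emeasure_mono) auto
    qed
  qed
qed

text \<open>This is \<open>f dm = (f / |f|) |f| dm\<close>. The zero set of \<open>f\<close> is null for \<open>|f| dm\<close>, so any number of
  modulus \<open>1\<close> may replace \<open>f / |f|\<close> there.\<close>

lemma polar_representation_bounded_density:
  fixes m :: "'x::metric_space measure"
  assumes proper: "proper_metric TYPE('x)" and m: "radon_measure m"
    and f: "f \<in> borel_measurable borel" and fB: "\<And>x. norm (f x) \<le> B"
  shows "polar_representation (density_functional m f) (density m (\<lambda>x. ennreal (norm (f x))))
           (\<lambda>x. if f x = 0 then 1 else sgn (f x))"
proof -
  let ?d = "density m (\<lambda>x. ennreal (norm (f x)))" and ?u = "\<lambda>x. if f x = 0 then 1 else sgn (f x)"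
  have d: "radon_measure ?d"
    using f fB by (intro radon_measure_density[OF proper m]) auto
  have u: "?u \<in> borel_measurable borel"
    unfolding sgn_div_norm using f by measurable
  have "density_functional m f = density_functional ?d ?u"
  proof
    fix \<phi> :: "'x \<Rightarrow> complex"
    show "density_functional m f \<phi> = density_functional ?d ?u \<phi>"
    proof (cases "\<phi> \<in> Cc")
      case True
      have \<phi>: "\<phi> \<in> borel_measurable borel"
        using True by (auto simp: Cc_def intro!: borel_measurable_continuous_onI)
      have "(LINT x|?d. \<phi> x * ?u x) = (LINT x|m. norm (f x) *\<^sub>R (\<phi> x * ?u x))"
        using \<phi> f u by (intro integral_density radon_measure_borel_measurable[OF m] AE_I2) auto
      also have "\<dots> = (LINT x|m. \<phi> x * f x)"
        by (intro Bochner_Integration.integral_cong) (auto simp: sgn_div_norm scaleR_conv_of_real)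
      finally show ?thesis
        by (simp add: density_functional_on_UNIV[OF m True] density_functional_on_UNIV[OF d True])
    qed (simp add: density_functional_on_def)
  qed
  with d u show ?thesis
    by (simp add: polar_representation_def norm_sgn)
qed

text \<open>The density here need not be unimodular, so the formula is read off a polar representation only
  through the comparison with \<open>(m, f)\<close>; this makes every polar representation yield the same
  functional, as the definite description requires.\<close>

lemma functional_cut_off_density_functional:
  fixes m :: "'x::metric_space measure"
  assumes proper: "proper_metric TYPE('x)" and m: "radon_measure m"
    and f: "f \<in> borel_measurable borel" and fB: "\<And>x. norm (f x) \<le> B"
    and C: "closed C"
  shows "functional_cut_off (density_functional m f) C = density_functional_on C m f"
proof -
  have uniq: "density_functional_on C m' u = density_functional_on C m f"
    if "polar_representation (density_functional m f) m' u" for m' u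
    using that unfolding polar_representation_def
    by (intro density_functional_on_cong[OF _ _ _ m f fB _ C, where B = 1]) auto
  show ?thesis
    unfolding functional_cut_off_def
    using uniq polar_representation_bounded_density[OF proper m f fB]
    by (intro the_equality) (metis, metis)
qed

section \<open>Haar measures\<close>

lemma haar_measure_radon: "haar_measure \<mu> \<Longrightarrow> radon_measure \<mu>"
  by (simp add: haar_measure_def)

lemma haar_measure_distr:
  fixes \<mu> :: "'g::topological_group_add measure"
  assumes \<mu>: "haar_measure \<mu>"
  shows "distr \<mu> \<mu> (\<lambda>x. g + x) = \<mu>"
proof (rule measure_eqI)
  note sets = radon_measure_sets[OF haar_measure_radon[OF \<mu>]]
  note space = radon_measure_space[OF haar_measure_radon[OF \<mu>]]
  have "(\<lambda>x. g + x) \<in> borel_measurable borel"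
    by (intro borel_measurable_continuous_onI continuous_intros)
  then have meas: "(\<lambda>x. g + x) \<in> measurable \<mu> \<mu>"
    by (simp only: measurable_cong_sets[OF sets sets])
  fix A assume "A \<in> sets (distr \<mu> \<mu> (\<lambda>x. g + x))"
  then have A: "A \<in> sets \<mu>" by simp
  have "(\<lambda>x. g + x) -` A = (\<lambda>x. - g + x) ` A"
    by (auto intro: image_eqI[of _ _ "g + _"])
  with A meas \<mu> show "emeasure (distr \<mu> \<mu> (\<lambda>x. g + x)) A = emeasure \<mu> A"
    by (simp add: emeasure_distr space haar_measure_def)
qed simp

text \<open>Balls of equal radius are translates of each other, so if one were null, all would be; finitely
  many cover each compact ball, and the whole group would be null.\<close>

lemma haar_measure_ball_pos:
  fixes \<mu> :: "'g::{topological_group_add, metric_space} measure"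
  assumes proper: "proper_metric TYPE('g)" and inv: "translation_invariant_metric TYPE('g)"
    and \<mu>: "haar_measure \<mu>" and "r > 0"
  shows "emeasure \<mu> (ball x r) \<noteq> 0"
proof
  assume 0: "emeasure \<mu> (ball x r) = 0"
  note sets = radon_measure_sets[OF haar_measure_radon[OF \<mu>]]
  have ball0: "ball y r \<in> null_sets \<mu>" for y
  proof -
    have "(\<lambda>z. (y - x) + z) ` ball x r = ball y r"
    proof (intro equalityI subsetI)
      fix w assume "w \<in> (\<lambda>z. (y - x) + z) ` ball x r"
      then obtain z where z: "w = (y - x) + z" "dist x z < r" by auto
      have "dist ((y - x) + x) ((y - x) + z) = dist x z"
        using inv unfolding translation_invariant_metric_def by blast
      with z show "w \<in> ball y r" by simp
    next
      fix w assume w: "w \<in> ball y r"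
      have "dist ((x - y) + y) ((x - y) + w) = dist y w"
        using inv unfolding translation_invariant_metric_def by blast
      with w have "(x - y) + w \<in> ball x r" by simp
      moreover have "w = (y - x) + ((x - y) + w)"
        by (metis add_minus_cancel minus_diff_eq)
      ultimately show "w \<in> (\<lambda>z. (y - x) + z) ` ball x r" by blast
    qed
    then have "emeasure \<mu> (ball y r) = emeasure \<mu> (ball x r)"
      using \<mu> by (metis haar_measure_def sets borel_open open_ball)
    with 0 show ?thesis by (auto simp: null_sets_def sets)
  qed
  have "cball 0 (real n) \<in> null_sets \<mu>" for n
  proof -
    have "compact (cball (0::'g) (real n))" using proper by (auto simp: proper_metric_def)
    then obtain T where T: "finite T" "cball (0::'g) (real n) \<subseteq> (\<Union>y\<in>T. ball y r)"
    proof (rule compactE_image)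
      show "cball 0 (real n) \<subseteq> (\<Union>y\<in>UNIV. ball y r)"
        using centre_in_ball \<open>r > 0\<close> by blast
    qed auto
    have "(\<Union>y\<in>T. ball y r) \<in> null_sets \<mu>"
      using T ball0 by (intro null_sets_UN') (auto intro: countable_finite)
    then show ?thesis
      by (rule null_sets_subset[OF _ _ T(2)]) (simp add: sets)
  qed
  then have "(\<Union>n. cball (0::'g) (real n)) \<in> null_sets \<mu>"
    by (intro null_sets_UN) auto
  moreover have "(\<Union>n. cball (0::'g) (real n)) = UNIV"
    using real_arch_simple by auto
  ultimately show False
    using \<mu> by (auto simp: haar_measure_def)
qed

lemma pattern_act_density_functional:
  fixes \<mu> :: "'g::{topological_group_add, t2_space} measure"
  assumes \<mu>: "haar_measure \<mu>" and f: "f \<in> borel_measurable borel"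
  shows "pattern_act (Cc_dual_space (+)) g (density_functional \<mu> f) =
    density_functional \<mu> (fun_act (+) g f)"
proof
  fix \<phi> :: "'g \<Rightarrow> complex"
  note radon = haar_measure_radon[OF \<mu>]
  note sets = radon_measure_sets[OF radon]
  have plus: "(\<lambda>x. h + x) \<in> borel_measurable borel" for h :: 'g
    by (intro borel_measurable_continuous_onI continuous_intros)
  then have plus': "(\<lambda>x. g + x) \<in> measurable \<mu> \<mu>"
    by (simp only: measurable_cong_sets[OF sets sets])
  show "pattern_act (Cc_dual_space (+)) g (density_functional \<mu> f) \<phi> =
    density_functional \<mu> (fun_act (+) g f) \<phi>"
  proof (cases "\<phi> \<in> Cc")
    case True
    then have \<phi>: "\<phi> \<in> borel_measurable borel"
      by (auto simp: Cc_def intro!: borel_measurable_continuous_onI)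
    have F: "(\<lambda>x. \<phi> x * f (- g + x)) \<in> borel_measurable borel"
      by (intro borel_measurable_times \<phi> measurable_compose[OF plus f])
    have "(LINT x|\<mu>. \<phi> x * f (- g + x)) = (LINT x|distr \<mu> \<mu> (\<lambda>x. g + x). \<phi> x * f (- g + x))"
      by (simp only: haar_measure_distr[OF \<mu>])
    also have "\<dots> = (LINT x|\<mu>. \<phi> (g + x) * f x)"
      by (subst integral_distr[OF plus' radon_measure_borel_measurable[OF radon F]])
        simp
    finally show ?thesis
      using True Cc_translate[OF True, of g]
      by (simp add: Cc_dual_space_def fun_act_def density_functional_on_UNIV[OF radon])
  next
    case False
    then show ?thesis
      by (simp add: Cc_dual_space_def fun_act_def density_functional_on_def Cc_translate_iff)
  qed
qed

text \<open>The test function is a bump at \<open>x\<close> times the conjugate of \<open>D = f - h\<close>, so that the difference of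
  the two functionals is the integral of the bump times \<open>|D|\<^sup>2\<close>. This integrand is continuous and
  nonnegative; its integral vanishes, so it vanishes almost everywhere, whereas it would be nonzero
  on a ball around \<open>x\<close>, which has positive measure, if \<open>D x \<noteq> 0\<close>.\<close>

lemma density_functional_on_cball_eqD:
  fixes \<mu> :: "'g::{topological_group_add, metric_space} measure"
  assumes proper: "proper_metric TYPE('g)" and inv: "translation_invariant_metric TYPE('g)"
    and \<mu>: "haar_measure \<mu>"
    and f: "continuous_on UNIV f" "\<And>x. norm (f x) \<le> B"
    and h: "continuous_on UNIV h" "\<And>x. norm (h x) \<le> B'"
    and eq: "density_functional_on C \<mu> f = density_functional_on C \<mu> h"
    and "r > 0" and sub: "cball x r \<subseteq> C"
  shows "f x = h x"
proof (rule ccontr)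
  assume neq: "f x \<noteq> h x"
  note radon = haar_measure_radon[OF \<mu>]
  define D where "D y = f y - h y" for y
  have D: "continuous_on UNIV D"
    unfolding D_def using f h by (intro continuous_intros)
  define \<psi> where "\<psi> y = max 0 (r - dist x y)" for y
  have \<psi>: "continuous_on UNIV \<psi>"
    unfolding \<psi>_def by (intro continuous_intros)
  define \<phi> where "\<phi> y = of_real (\<psi> y) * cnj (D y)" for y
  have \<phi>: "\<phi> \<in> Cc"
  proof (rule CcI)
    show "continuous_on UNIV \<phi>"
      unfolding \<phi>_def using D \<psi> by (intro continuous_intros)
    show "compact (cball x r)" using proper by (auto simp: proper_metric_def)
    show "\<phi> y = 0" if "y \<notin> cball x r" for y
      using that by (simp add: \<phi>_def \<psi>_def max_absorb1)
  qed
  \<comment> \<open>the bump lives inside \<open>C\<close>, so the restriction of the functionals to \<open>C\<close> is invisible to it\<close>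
  have 0: "\<phi> y = 0" if "y \<notin> C" for y
  proof -
    have "y \<notin> cball x r" using that sub by blast
    then show ?thesis by (simp add: \<phi>_def \<psi>_def max_absorb1)
  qed
  have on_C: "density_functional_on C \<mu> k \<phi> = (LINT y|\<mu>. \<phi> y * k y)" for k
    unfolding density_functional_on_def set_lebesgue_integral_def
    using \<phi> 0 by (auto intro!: Bochner_Integration.integral_cong simp: indicator_def)
  have int: "integrable \<mu> (\<lambda>y. \<phi> y * f y)" "integrable \<mu> (\<lambda>y. \<phi> y * h y)"
    using f h by (auto intro!: integrable_Cc_times_bounded[OF radon \<phi>] borel_measurable_continuous_onI)
  let ?F = "\<lambda>y. \<psi> y * (norm (D y))\<^sup>2"
  have F: "\<phi> y * f y - \<phi> y * h y = of_real (?F y)" for y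
  proof -
    have "\<phi> y * f y - \<phi> y * h y = of_real (\<psi> y) * (D y * cnj (D y))"
      by (simp add: \<phi>_def D_def algebra_simps)
    then show ?thesis by (simp add: complex_norm_square[symmetric])
  qed
  have intF: "integrable \<mu> ?F"
    using Bochner_Integration.integrable_diff[OF int] unfolding F
    by (simp only: complex_of_real_integrable_eq)
  have "complex_of_real (LINT y|\<mu>. ?F y) = (LINT y|\<mu>. \<phi> y * f y - \<phi> y * h y)"
    unfolding F by (rule integral_complex_of_real[symmetric])
  also have "\<dots> = 0"
    using fun_cong[OF eq, of \<phi>] int by (simp add: on_C)
  finally have "(LINT y|\<mu>. ?F y) = 0" by simp
  then have AE: "AE y in \<mu>. ?F y = 0"
    using intF by (subst (asm) integral_nonneg_eq_0_iff_AE) (auto simp: \<psi>_def)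
  have cF: "continuous_on UNIV ?F"
    using D \<psi> by (intro continuous_intros)
  then have "open {y. ?F y \<noteq> 0}"
    by (intro open_Collect_neq continuous_on_const)
  moreover have "?F x \<noteq> 0"
    using neq \<open>r > 0\<close> by (simp add: \<psi>_def D_def)
  ultimately obtain s where "s > 0" and s: "ball x s \<subseteq> {y. ?F y \<noteq> 0}"
    by (metis (mono_tags, lifting) mem_Collect_eq open_contains_ball)
  have "AE y in \<mu>. y \<notin> ball x s"
    using AE by eventually_elim (use s in auto)
  then have "emeasure \<mu> (ball x s) = 0"
    by (subst (asm) AE_iff_measurable[where N = "ball x s"])
      (auto simp: radon_measure_sets[OF radon] radon_measure_space[OF radon])
  with haar_measure_ball_pos[OF proper inv \<mu> \<open>s > 0\<close>] show False by blast
qed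

theorem proposition3p26:
  fixes \<mu> :: "'g::{topological_ab_group_add, metric_space} measure"
    and f :: "'g \<Rightarrow> complex"
  assumes "locally compact (UNIV :: 'g set)"
    and "sigma_compact (UNIV :: 'g set)"
    and "proper_metric TYPE('g)"
    and "translation_invariant_metric TYPE('g)"
    and "haar_measure \<mu>"
    and "continuous_on UNIV f"
    and "bounded (range f)"
  shows "mutually_locally_derivable
           (Map_space ((+) :: 'g \<Rightarrow> 'g \<Rightarrow> 'g)) f
           (Cc_dual_space ((+) :: 'g \<Rightarrow> 'g \<Rightarrow> 'g)) (density_functional \<mu> f)"
proof -
  note proper = assms(3) and inv = assms(4) and \<mu> = assms(5)
  note radon = haar_measure_radon[OF \<mu>]
  let ?S = "Map_space ((+) :: 'g \<Rightarrow> 'g \<Rightarrow> 'g)" and ?T = "Cc_dual_space ((+) :: 'g \<Rightarrow> 'g \<Rightarrow> 'g)"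
  let ?\<Phi> = "density_functional \<mu> f"
  obtain B where B: "norm (f x) \<le> B" for x
    using assms(7) by (auto simp: bounded_iff)
  have f: "f \<in> borel_measurable borel"
    by (rule borel_measurable_continuous_onI[OF assms(6)])
  define f' where "f' g = fun_act (+) g f" for g
  have f'_cont: "continuous_on UNIV (f' g)" for g
    unfolding f'_def fun_act_def
    by (rule continuous_on_compose2[OF assms(6)]) (auto intro!: continuous_intros)
  have f'B: "norm (f' g x) \<le> B" for g x
    by (simp add: f'_def fun_act_def B)
  have S: "cut_off ?S (pattern_act ?S g f) C = (\<lambda>x. if x \<in> C then f' g x else 0)" for g C
    unfolding f'_def by (simp add: Map_space_def)
  have T: "cut_off ?T (pattern_act ?T g ?\<Phi>) C = density_functional_on C \<mu> (f' g)"
    if "closed C" for g C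
  proof -
    have "cut_off ?T (pattern_act ?T g ?\<Phi>) C = functional_cut_off (density_functional \<mu> (f' g)) C"
      unfolding pattern_act_density_functional[OF \<mu> f] f'_def by (simp add: Cc_dual_space_def)
    also have "\<dots> = density_functional_on C \<mu> (f' g)"
      using functional_cut_off_density_functional[OF proper radon
          borel_measurable_continuous_onI[OF f'_cont] f'B that] .
    finally show ?thesis .
  qed
  have f_in: "f \<in> patterns ?S" and \<Phi>_in: "?\<Phi> \<in> patterns ?T"
    using density_functional_in_Cc_dual[OF radon f B] by (simp_all add: Map_space_def Cc_dual_space_def)
  have "locally_derivable_from ?S f ?T ?\<Phi>"
    unfolding locally_derivable_from_def
  proof (intro conjI f_in \<Phi>_in exI[of _ 0] allI impI)
    fix g h :: 'g and R :: real
    assume "cut_off ?S (pattern_act ?S g f) (cball 0 (R + 0)) = cut_off ?S (pattern_act ?S h f) (cball 0 (R + 0))"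
    then have "f' g x = f' h x" if "x \<in> cball 0 R" for x
      using that unfolding S by (auto dest: fun_cong[of _ _ x])
    then have "density_functional_on (cball 0 R) \<mu> (f' g) = density_functional_on (cball 0 R) \<mu> (f' h)"
      unfolding density_functional_on_def set_lebesgue_integral_def
      by (auto intro!: ext Bochner_Integration.integral_cong simp: indicator_def)
    then show "cut_off ?T (pattern_act ?T g ?\<Phi>) (cball 0 R) = cut_off ?T (pattern_act ?T h ?\<Phi>) (cball 0 R)"
      by (simp only: T[OF closed_cball])
  qed simp
  moreover have "locally_derivable_from ?T ?\<Phi> ?S f"
    unfolding locally_derivable_from_def
  proof (intro conjI f_in \<Phi>_in exI[of _ "0::'g"] exI[of _ "1::real"] allI impI)
    fix g h :: 'g and R :: real
    assume eq: "cut_off ?T (pattern_act ?T g ?\<Phi>) (cball 0 (R + 1)) = cut_off ?T (pattern_act ?T h ?\<Phi>) (cball 0 (R + 1))"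
    have "f' g x = f' h x" if "x \<in> cball 0 R" for x
    proof (rule density_functional_on_cball_eqD[OF proper inv \<mu> f'_cont f'B f'_cont f'B])
      show "density_functional_on (cball 0 (R + 1)) \<mu> (f' g) = density_functional_on (cball 0 (R + 1)) \<mu> (f' h)"
        using eq unfolding T[OF closed_cball] .
      show "cball x 1 \<subseteq> cball 0 (R + 1)"
        using that by (auto simp: subset_iff intro: order_trans[OF dist_triangle[of _ _ x]])
    qed auto
    then show "cut_off ?S (pattern_act ?S g f) (cball 0 R) = cut_off ?S (pattern_act ?S h f) (cball 0 R)"
      unfolding S by auto
  qed simp
  ultimately show ?thesis
    by (simp add: mutually_locally_derivable_def)
qed

end
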